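(* Let $R$ be a commutative ring with nonzero identity, $M$ a unitary $R$-module, and $a\in R$ an element such that $aM\neq M$. Suppose $(0:_Ma)\subseteq aM$. Then $aM$ is a $\phi_1$-prime submodule of $M$ if and only if $aM$ is a prime submodule of $M$.
   Context: For a submodule $N$ of $M$, $(N:_RM)=\{r\in R: rM\subseteq N\}$, and $(0:_Ma)=\{x\in M: ax=0\}$. A proper submodule $P$ of $M$ is prime if for all $r\in R$, $x\in M$, $rx\in P$ implies $r\in(P:_RM)$ or $x\in P$. A proper submodule $P$ of $M$ is $\phi_1$-prime if for all $r\in R$, $x\in M$, $rx\in P\setminus (P:_RM)P$ implies $r\in(P:_RM)$ or $x\in P$. *)

theory Defs
  imports "HOL-Algebra.Module"
begin

text \<open>The submodule \<open>aM\<close>.\<close>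

definition smult_set :: "('a, 'b, 'c) module_scheme \<Rightarrow> 'a \<Rightarrow> 'b set"
  where "smult_set M a = (\<lambda>x. a \<odot>\<^bsub>M\<^esub> x) ` carrier M"

text \<open>The residual \<open>(N :\<^sub>R M)\<close>.\<close>

definition residual ::
    "('a, 'd) ring_scheme \<Rightarrow> ('a, 'b, 'c) module_scheme \<Rightarrow> 'b set \<Rightarrow> 'a set"
  where "residual R M N = {r \<in> carrier R. smult_set M r \<subseteq> N}"

text \<open>The set \<open>(0 :\<^sub>M a)\<close>.\<close>

definition zero_residual :: "('a, 'b, 'c) module_scheme \<Rightarrow> 'a \<Rightarrow> 'b set"
  where "zero_residual M a = {x \<in> carrier M. a \<odot>\<^bsub>M\<^esub> x = \<zero>\<^bsub>M\<^esub>}"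

text \<open>The product \<open>IN\<close> of an ideal and a submodule: the submodule generated by
  all products \<open>in\<close>, not merely the set of these products.\<close>

definition ideal_smult ::
    "('a, 'd) ring_scheme \<Rightarrow> ('a, 'b, 'c) module_scheme \<Rightarrow> 'a set \<Rightarrow> 'b set \<Rightarrow> 'b set"
  where "ideal_smult R M I N =
    \<Inter>{K. submodule K R M \<and> (\<forall>i\<in>I. \<forall>n\<in>N. i \<odot>\<^bsub>M\<^esub> n \<in> K)}"

definition prime_submodule ::
    "('a, 'd) ring_scheme \<Rightarrow> ('a, 'b, 'c) module_scheme \<Rightarrow> 'b set \<Rightarrow> bool"
  where "prime_submodule R M P \<longleftrightarrow>
    submodule P R M \<and> P \<noteq> carrier M \<and>
    (\<forall>r\<in>carrier R. \<forall>x\<in>carrier M.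
      r \<odot>\<^bsub>M\<^esub> x \<in> P \<longrightarrow> r \<in> residual R M P \<or> x \<in> P)"

definition phi1_prime_submodule ::
    "('a, 'd) ring_scheme \<Rightarrow> ('a, 'b, 'c) module_scheme \<Rightarrow> 'b set \<Rightarrow> bool"
  where "phi1_prime_submodule R M P \<longleftrightarrow>
    submodule P R M \<and> P \<noteq> carrier M \<and>
    (\<forall>r\<in>carrier R. \<forall>x\<in>carrier M.
      r \<odot>\<^bsub>M\<^esub> x \<in> P - ideal_smult R M (residual R M P) P \<longrightarrow>
      r \<in> residual R M P \<or> x \<in> P)"

end

theory Submission
  imports Defs
begin

text \<open>
  Let \<open>rx \<in> aM\<close>. If \<open>rx\<close> or \<open>(r + a)x\<close> lies outside \<open>(aM : M)aM\<close>, the \<open>\<phi>\<^sub>1\<close>-prime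
  property applies to \<open>r\<close> or to \<open>r + a\<close>, and \<open>a \<in> (aM : M)\<close>. Otherwise
  \<open>ax = (r + a)x - rx\<close> lies in \<open>a(aM)\<close>, since \<open>(aM : M)aM \<subseteq> a(aM)\<close>. So \<open>x\<close> differs from an
  element of \<open>aM\<close> by an element of \<open>(0 : a) \<subseteq> aM\<close>.
\<close>

context module
begin

lemma smult_left_commute:
  assumes "a \<in> carrier R" "b \<in> carrier R" "x \<in> carrier M"
  shows "a \<odot>\<^bsub>M\<^esub> (b \<odot>\<^bsub>M\<^esub> x) = b \<odot>\<^bsub>M\<^esub> (a \<odot>\<^bsub>M\<^esub> x)"
  using assms by (simp add: smult_assoc1[symmetric] R.m_comm)

text \<open>Scaling by \<open>a\<close> is linear because \<open>R\<close> is commutative, so it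
  carries submodules to submodules. It is needed twice: \<open>N = carrier M\<close> gives
  \<open>aM\<close>, and \<open>N = aM\<close> gives \<open>a(aM)\<close>.\<close>

lemma submodule_smult_image:
  assumes "a \<in> carrier R" "submodule N R M"
  shows "submodule ((\<lambda>x. a \<odot>\<^bsub>M\<^esub> x) ` N) R M"
proof -
  have NM: "N \<subseteq> carrier M"
    using assms(2) by (rule submoduleE(1))
  show ?thesis
  proof (rule submoduleI)
    show "(\<lambda>x. a \<odot>\<^bsub>M\<^esub> x) ` N \<subseteq> carrier M"
      using NM assms(1) by auto
    have "\<zero>\<^bsub>M\<^esub> \<in> N"
      using subgroup.one_closed[OF submodule.axioms(1)[OF assms(2)]] by simp
    then show "\<zero>\<^bsub>M\<^esub> \<in> (\<lambda>x. a \<odot>\<^bsub>M\<^esub> x) ` N"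
      using assms(1) by (intro image_eqI[of _ _ "\<zero>\<^bsub>M\<^esub>"]) auto
  next
    fix u assume "u \<in> (\<lambda>x. a \<odot>\<^bsub>M\<^esub> x) ` N"
    then obtain x where "x \<in> N" "u = a \<odot>\<^bsub>M\<^esub> x" by blast
    moreover have "\<ominus>\<^bsub>M\<^esub> x \<in> N"
      using assms(2) \<open>x \<in> N\<close> by (rule submoduleE(3))
    ultimately show "\<ominus>\<^bsub>M\<^esub> u \<in> (\<lambda>x. a \<odot>\<^bsub>M\<^esub> x) ` N"
      using NM assms(1) by (auto simp: subset_iff smult_r_minus[symmetric])
  next
    fix u v assume "u \<in> (\<lambda>x. a \<odot>\<^bsub>M\<^esub> x) ` N" "v \<in> (\<lambda>x. a \<odot>\<^bsub>M\<^esub> x) ` N"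
    then obtain x y where "x \<in> N" "y \<in> N" "u = a \<odot>\<^bsub>M\<^esub> x" "v = a \<odot>\<^bsub>M\<^esub> y" by blast
    moreover have "x \<oplus>\<^bsub>M\<^esub> y \<in> N"
      using assms(2) \<open>x \<in> N\<close> \<open>y \<in> N\<close> by (rule submoduleE(5))
    ultimately show "u \<oplus>\<^bsub>M\<^esub> v \<in> (\<lambda>x. a \<odot>\<^bsub>M\<^esub> x) ` N"
      using NM assms(1) by (auto simp: subset_iff smult_r_distr[symmetric])
  next
    fix r u assume r: "r \<in> carrier R" and "u \<in> (\<lambda>x. a \<odot>\<^bsub>M\<^esub> x) ` N"
    then obtain x where x: "x \<in> N" "u = a \<odot>\<^bsub>M\<^esub> x" by blast
    moreover have "r \<odot>\<^bsub>M\<^esub> x \<in> N"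
      using assms(2) r x(1) by (rule submoduleE(4))
    moreover have "r \<odot>\<^bsub>M\<^esub> u = a \<odot>\<^bsub>M\<^esub> (r \<odot>\<^bsub>M\<^esub> x)"
      using NM r x assms(1) by (auto intro: smult_left_commute)
    ultimately show "r \<odot>\<^bsub>M\<^esub> u \<in> (\<lambda>x. a \<odot>\<^bsub>M\<^esub> x) ` N"
      by blast
  qed
qed

lemma submodule_smult_set:
  "a \<in> carrier R \<Longrightarrow> submodule (smult_set M a) R M"
  unfolding smult_set_def by (intro submodule_smult_image carrier_is_submodule)

text \<open>The right-hand side is itself one of the submodules being intersected: if
  \<open>iM\<close> lies in \<open>aM\<close>, then \<open>i(am) = a(im)\<close> with
  \<open>im\<close> in \<open>aM\<close>. This replaces the generated product by a set whose
  elements have the explicit form \<open>ay\<close>, \<open>y\<close> in \<open>aM\<close>.\<close>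

lemma ideal_smult_residual_subset:
  assumes "a \<in> carrier R"
  shows "ideal_smult R M (residual R M (smult_set M a)) (smult_set M a)
    \<subseteq> (\<lambda>x. a \<odot>\<^bsub>M\<^esub> x) ` smult_set M a"
  unfolding ideal_smult_def
proof (intro Inter_lower CollectI conjI ballI)
  show "submodule ((\<lambda>x. a \<odot>\<^bsub>M\<^esub> x) ` smult_set M a) R M"
    using assms by (intro submodule_smult_image submodule_smult_set)
next
  fix i n assume i: "i \<in> residual R M (smult_set M a)" and "n \<in> smult_set M a"
  then obtain m where m: "m \<in> carrier M" "n = a \<odot>\<^bsub>M\<^esub> m"
    unfolding smult_set_def by blast
  have iR: "i \<in> carrier R"
    using i unfolding residual_def by blast
  have "i \<odot>\<^bsub>M\<^esub> m \<in> smult_set M a"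
    using i m(1) unfolding residual_def smult_set_def by blast
  moreover have "i \<odot>\<^bsub>M\<^esub> n = a \<odot>\<^bsub>M\<^esub> (i \<odot>\<^bsub>M\<^esub> m)"
    using m iR assms by (simp add: smult_left_commute)
  ultimately show "i \<odot>\<^bsub>M\<^esub> n \<in> (\<lambda>x. a \<odot>\<^bsub>M\<^esub> x) ` smult_set M a"
    by blast
qed

text \<open>Write \<open>rx = (r + a)x - ax\<close>. With \<open>N = aM\<close> this shows that
  passing from \<open>r\<close> to \<open>r + a\<close> does not lead into the residual.\<close>

lemma residual_add_cancel:
  assumes "submodule N R M" "r \<in> carrier R" "a \<in> residual R M N" "r \<oplus> a \<in> residual R M N"
  shows "r \<in> residual R M N"
proof -
  have a: "a \<in> carrier R"
    using assms(3) unfolding residual_def by blast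
  have "r \<odot>\<^bsub>M\<^esub> x \<in> N" if x: "x \<in> carrier M" for x
  proof -
    have "a \<odot>\<^bsub>M\<^esub> x \<in> N" "(r \<oplus> a) \<odot>\<^bsub>M\<^esub> x \<in> N"
      using assms(3,4) x unfolding residual_def smult_set_def by blast+
    then have "(r \<oplus> a) \<odot>\<^bsub>M\<^esub> x \<oplus>\<^bsub>M\<^esub> \<ominus>\<^bsub>M\<^esub> (a \<odot>\<^bsub>M\<^esub> x) \<in> N"
      using assms(1) by (intro submoduleE(3,5))
    moreover have "(r \<oplus> a) \<odot>\<^bsub>M\<^esub> x \<oplus>\<^bsub>M\<^esub> \<ominus>\<^bsub>M\<^esub> (a \<odot>\<^bsub>M\<^esub> x) = r \<odot>\<^bsub>M\<^esub> x"
      using a assms(2) x by (simp add: smult_l_distr M.a_assoc M.r_neg)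
    ultimately show ?thesis by simp
  qed
  then show ?thesis
    using assms(2) unfolding residual_def smult_set_def by blast
qed

text \<open>This is where \<open>(0 : a)\<close> being inside \<open>aM\<close> enters. If
  \<open>ax = ay\<close> with \<open>y\<close> in \<open>aM\<close>, then \<open>a\<close> kills
  \<open>x - y\<close>, so both summands of \<open>x = (x - y) + y\<close> lie in
  \<open>aM\<close>.\<close>

lemma mem_smult_set_if_smult_mem:
  assumes a: "a \<in> carrier R" and x: "x \<in> carrier M"
    and zero: "zero_residual M a \<subseteq> smult_set M a"
    and "a \<odot>\<^bsub>M\<^esub> x \<in> (\<lambda>y. a \<odot>\<^bsub>M\<^esub> y) ` smult_set M a"
  shows "x \<in> smult_set M a"
proof -
  obtain y where y: "y \<in> smult_set M a" "a \<odot>\<^bsub>M\<^esub> x = a \<odot>\<^bsub>M\<^esub> y"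
    using assms(4) by blast
  have yM: "y \<in> carrier M"
    using y(1) submoduleE(1)[OF submodule_smult_set[OF a]] by blast
  have "x \<oplus>\<^bsub>M\<^esub> \<ominus>\<^bsub>M\<^esub> y \<in> zero_residual M a"
    unfolding zero_residual_def using a x yM y(2)
    by (simp add: smult_r_distr smult_r_minus M.r_neg)
  then have "(x \<oplus>\<^bsub>M\<^esub> \<ominus>\<^bsub>M\<^esub> y) \<oplus>\<^bsub>M\<^esub> y \<in> smult_set M a"
    using zero y(1) submoduleE(5)[OF submodule_smult_set[OF a]] by blast
  then show ?thesis
    using x yM by (simp add: M.a_assoc M.l_neg)
qed

lemma phi1_prime_smult_set_imp_prime:
  assumes a: "a \<in> carrier R"
    and zero: "zero_residual M a \<subseteq> smult_set M a"
    and phi: "phi1_prime_submodule R M (smult_set M a)"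
  shows "prime_submodule R M (smult_set M a)"
proof -
  let ?P = "smult_set M a"
  let ?I = "residual R M ?P"
  let ?K = "(\<lambda>y. a \<odot>\<^bsub>M\<^esub> y) ` ?P"
  have subP: "submodule ?P R M" and subK: "submodule ?K R M"
    using a by (auto intro: submodule_smult_image submodule_smult_set)
  have aI: "a \<in> ?I"
    using a unfolding residual_def by blast
  \<comment> \<open>A pair \<open>(s, x)\<close> that violates primeness is compatible with
    \<open>phi\<close> only if \<open>sx\<close> falls into the excluded product, hence into
    \<open>?K\<close>. This is used for \<open>s = r\<close> and for
    \<open>s = r + a\<close>.\<close>
  have inK: "s \<odot>\<^bsub>M\<^esub> x \<in> ?K"
    if "s \<in> carrier R" "x \<in> carrier M" "s \<odot>\<^bsub>M\<^esub> x \<in> ?P" "s \<notin> ?I" "x \<notin> ?P" for s x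
  proof (rule ccontr)
    assume "s \<odot>\<^bsub>M\<^esub> x \<notin> ?K"
    then have "s \<odot>\<^bsub>M\<^esub> x \<in> ?P - ideal_smult R M ?I ?P"
      using ideal_smult_residual_subset[OF a] that(3) by blast
    then show False
      using phi that(1,2,4,5) unfolding phi1_prime_submodule_def by blast
  qed
  have "r \<in> ?I \<or> x \<in> ?P" if r: "r \<in> carrier R" and x: "x \<in> carrier M"
    and rx: "r \<odot>\<^bsub>M\<^esub> x \<in> ?P" for r x
  proof (rule ccontr)
    assume neg: "\<not> (r \<in> ?I \<or> x \<in> ?P)"
    have "a \<odot>\<^bsub>M\<^esub> x \<in> ?P"
      using x unfolding smult_set_def by blast
    then have "(r \<oplus> a) \<odot>\<^bsub>M\<^esub> x \<in> ?P"
      using submoduleE(5)[OF subP rx] r a x by (simp add: smult_l_distr)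
    \<comment> \<open>So \<open>(r + a, x)\<close> violates primeness just as \<open>(r, x)\<close>
      does.\<close>
    moreover have "r \<oplus> a \<notin> ?I"
      using residual_add_cancel[OF subP r aI] neg by blast
    ultimately have "r \<odot>\<^bsub>M\<^esub> x \<in> ?K" "(r \<oplus> a) \<odot>\<^bsub>M\<^esub> x \<in> ?K"
      using inK[OF r x rx] inK[OF R.a_closed[OF r a] x] neg by blast+
    \<comment> \<open>The negative term stands first so that, once \<open>(r + a)x\<close> is
      expanded, regrouping to the left cancels \<open>rx\<close> and leaves
      \<open>ax\<close>.\<close>
    then have "\<ominus>\<^bsub>M\<^esub> (r \<odot>\<^bsub>M\<^esub> x) \<oplus>\<^bsub>M\<^esub> (r \<oplus> a) \<odot>\<^bsub>M\<^esub> x \<in> ?K"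
      using subK by (intro submoduleE(3,5))
    moreover have "\<ominus>\<^bsub>M\<^esub> (r \<odot>\<^bsub>M\<^esub> x) \<oplus>\<^bsub>M\<^esub> (r \<oplus> a) \<odot>\<^bsub>M\<^esub> x = a \<odot>\<^bsub>M\<^esub> x"
      using r a x by (simp add: smult_l_distr M.a_assoc[symmetric] M.l_neg)
    \<comment> \<open>Now \<open>ax\<close> lies in \<open>a(aM)\<close>, which forces
      \<open>x\<close> into \<open>aM\<close>, against \<open>neg\<close>.\<close>
    ultimately show False
      using mem_smult_set_if_smult_mem[OF a x zero] neg by simp
  qed
  then show ?thesis
    using phi unfolding phi1_prime_submodule_def prime_submodule_def by blast
qed

end

text \<open>Removing the product from \<open>P\<close> only leaves fewer pairs \<open>(r, x)\<close>
  to test.\<close>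

lemma prime_imp_phi1_prime_submodule:
  "prime_submodule R M P \<Longrightarrow> phi1_prime_submodule R M P"
  unfolding phi1_prime_submodule_def prime_submodule_def by blast

theorem theorem2p10:
  fixes R :: "('a, 'd) ring_scheme" and M :: "('a, 'b, 'c) module_scheme" and a :: 'a
  assumes "cring R" and "\<one>\<^bsub>R\<^esub> \<noteq> \<zero>\<^bsub>R\<^esub>"
    and "module R M"
    and "a \<in> carrier R"
    and "smult_set M a \<noteq> carrier M"
    and "zero_residual M a \<subseteq> smult_set M a"
  shows "phi1_prime_submodule R M (smult_set M a) \<longleftrightarrow> prime_submodule R M (smult_set M a)"
  using module.phi1_prime_smult_set_imp_prime[OF assms(3,4,6)] prime_imp_phi1_prime_submodule
  by blast

end
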